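(* Let $R$ be a finite commutative ring with unit element. Then, $s(R)=|R|$ holds if and only if $R$ is one of the following: (a) $R$ is a finite field, or (b) $R$ is $\mathbb{Z}_4$, or (c) $R$ is the ring $\rho$ with four elements $\{0,1,a,1+a\}$ with $1+1=0$ and $a^2=0$.
   Context: For a commutative ring $R$ with unit element, define $$s(R):=\min\{m\in\mathbb{N} : \exists\, p\in R[x] \text{ with } \deg(p)<m \text{ and } p(x)=x^m \text{ for all } x\in R\},$$ with $s(R):=\infty$ if no such $m$ exists; here $\mathbb{N}$ denotes the positive integers. $|R|$ denotes the cardinality of $R$, and $\mathbb{Z}_4=\mathbb{Z}/4\mathbb{Z}$ is the ring of integers modulo $4$. Rings are identified up to isomorphism.
   Formalization: The ring is assumed nonzero (1 ≠ 0): the zero ring has s(R) = 1 = |R| but is neither a field, nor ℤ₄, nor ρ, so the claim read literally fails for it; no other ring is excluded. *)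

theory Defs
  imports "HOL-Algebra.Polynomials" "HOL-Algebra.IntRing" "HOL-Library.Extended_Nat"
begin

text \<open>Univariate polynomials are the coefficient lists of \<^theory>\<open>HOL-Algebra.Polynomials\<close>. There the
  zero polynomial has degree 0 instead of a negative degree; as \<open>m\<close> below is positive, it satisfies
  the degree bound under either convention.\<close>

definition reduces_power :: "('a, 'b) ring_scheme \<Rightarrow> nat \<Rightarrow> bool" where
  "reduces_power R m \<longleftrightarrow>
     (\<exists>p \<in> carrier (univ_poly R (carrier R)). degree p < m \<and> (\<forall>x \<in> carrier R. ring.eval R p x = x [^]\<^bsub>R\<^esub> m))"

definition ring_s :: "('a, 'b) ring_scheme \<Rightarrow> enat" where
  "ring_s R = (if \<exists>m>0. reduces_power R m then enat (LEAST m. m > 0 \<and> reduces_power R m) else \<infinity>)"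

text \<open>The ring \<open>\<rho>\<close> is determined up to isomorphism by its presentation, so being \<open>\<rho>\<close> is rendered
  as a property of \<open>R\<close>; the cardinality makes the four listed elements distinct.\<close>

definition is_rho :: "('a, 'b) ring_scheme \<Rightarrow> bool" where
  "is_rho R \<longleftrightarrow> card (carrier R) = 4 \<and>
     (\<exists>a \<in> carrier R. carrier R = {\<zero>\<^bsub>R\<^esub>, \<one>\<^bsub>R\<^esub>, a, \<one>\<^bsub>R\<^esub> \<oplus>\<^bsub>R\<^esub> a} \<and>
        \<one>\<^bsub>R\<^esub> \<oplus>\<^bsub>R\<^esub> \<one>\<^bsub>R\<^esub> = \<zero>\<^bsub>R\<^esub> \<and> a [^]\<^bsub>R\<^esub> (2::nat) = \<zero>\<^bsub>R\<^esub>)"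

end

theory Submission
  imports Defs "HOL-Algebra.Polynomial_Divisibility"
begin

text \<open>
  The relation \<open>p(x) = x\<^sup>m\<close> on \<open>R\<close> with \<open>deg p < m\<close> says that the monic polynomial \<open>X\<^sup>m - p\<close>
  vanishes on all of \<open>R\<close>, so \<open>s(R)\<close> is the least degree of a monic polynomial that vanishes
  on \<open>R\<close>. Such degrees are closed upwards (multiply by \<open>X\<close>), and \<open>n = |R|\<close> is one of them, by the
  product of all \<open>X - r\<close>. Hence \<open>s(R) = n\<close> means precisely that no monic polynomial of degree
  \<open>n - 1\<close> vanishes on \<open>R\<close> (\<open>ring_s_eq_card_iff\<close>).

  For an ideal \<open>I\<close>, the product of \<open>X - r\<close> over representatives \<open>r\<close> of the cosets of \<open>I\<close> takes
  all its values in \<open>I\<close>. If \<open>I J = 0\<close>, two such products multiply to a vanishing polynomial of degree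
  \<open>|R/I| + |R/J|\<close> (\<open>reduces_power_index_add\<close>). If \<open>R\<close> is not a field, take a nonzero
  non-unit \<open>a\<close>, \<open>I = Ra\<close> and \<open>J = Ann a\<close>. Both ideals are nonzero, so both indices are at most
  \<open>n/2\<close>, and \<open>s(R) = n\<close> forces \<open>|I| = |J| = 2\<close>. As \<open>ax\<close> is \<open>0\<close> or \<open>a\<close> for every \<open>x\<close>, the ring is
  \<open>J \<union> (1 + J)\<close>, which leaves four elements. If \<open>a\<^sup>2 = a\<close>, then \<open>R\<close> is \<open>\<int>\<^sub>2 \<times> \<int>\<^sub>2\<close>, where
  \<open>X\<^sup>2 - X\<close> vanishes; so \<open>a\<^sup>2 = 0\<close>, and \<open>R = {0, 1, a, 1 + a}\<close> with \<open>2a = 0\<close>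
  (\<open>nonfield_structure\<close>). Here \<open>1 + 1\<close> is \<open>0\<close> or \<open>a\<close>, which gives \<open>\<rho>\<close> and \<open>\<int>\<^sub>4\<close>.

  Conversely, a polynomial of degree \<open>n - 1\<close> over a field has too few roots. In \<open>\<rho>\<close> and
  \<open>\<int>\<^sub>4\<close> there is \<open>a \<noteq> 0\<close> with \<open>a\<^sup>2 = 2a = 0\<close>, and then every monic cubic \<open>f\<close> satisfies
  \<open>f(1 + a) - f(1) - f(a) + f(0) = a\<close>, so it does not vanish on the ring.
\<close>

section \<open>Monic polynomial functions\<close>

text \<open>The lower-order part is an arbitrary list of length at most \<open>d\<close>, leading zeros allowed, so
  that sums and products need no normalization.\<close>

definition (in ring) monic_fun :: "nat \<Rightarrow> ('a \<Rightarrow> 'a) \<Rightarrow> bool" where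
  "monic_fun d f \<longleftrightarrow>
     (\<exists>p. set p \<subseteq> carrier R \<and> length p \<le> d \<and> (\<forall>x\<in>carrier R. f x = x [^] d \<oplus> eval p x))"

lemma (in ring) monic_funE:
  assumes "monic_fun d f"
  obtains p where "set p \<subseteq> carrier R" "length p = d"
    "\<forall>x\<in>carrier R. f x = x [^] d \<oplus> eval p x"
proof -
  obtain p where p: "set p \<subseteq> carrier R" "length p \<le> d"
      "\<forall>x\<in>carrier R. f x = x [^] d \<oplus> eval p x"
    using assms unfolding monic_fun_def by blast
  show thesis
    by (rule that[of "replicate (d - length p) \<zero> @ p"])
      (use p in \<open>auto simp: eval_replicate set_replicate_conv_if\<close>)
qed

lemma (in ring) eval_map_uminus:
  assumes "set p \<subseteq> carrier R" "x \<in> carrier R"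
  shows "eval (map (\<lambda>c. \<ominus> c) p) x = \<ominus> eval p x"
  using assms
proof (induction p)
  case (Cons c p)
  then show ?case
    using eval_in_carrier[of p x] by (simp add: minus_add l_minus a_comm)
qed simp

lemma (in ring) reduces_power_iff_monic_fun:
  assumes "m > 0"
  shows "reduces_power R m \<longleftrightarrow> monic_fun m (\<lambda>_. \<zero>)"
proof
  assume "reduces_power R m"
  then have "\<exists>p. polynomial (carrier R) p \<and> degree p < m \<and> (\<forall>x\<in>carrier R. eval p x = x [^] m)"
    unfolding reduces_power_def Bex_def univ_poly_carrier .
  then obtain p where p: "polynomial (carrier R) p" "degree p < m"
      "\<forall>x\<in>carrier R. eval p x = x [^] m"
    by (elim exE conjE)
  have c: "set p \<subseteq> carrier R"
    using polynomial_in_carrier[OF carrier_is_subring p(1)] .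
  have "set (map (\<lambda>c. \<ominus> c) p) \<subseteq> carrier R" using c by auto
  moreover have "length (map (\<lambda>c. \<ominus> c) p) \<le> m" using p(2) by simp
  moreover have "\<zero> = x [^] m \<oplus> eval (map (\<lambda>c. \<ominus> c) p) x" if "x \<in> carrier R" for x
    using that p(3) c by (simp add: eval_map_uminus r_neg)
  ultimately show "monic_fun m (\<lambda>_. \<zero>)"
    unfolding monic_fun_def by blast
next
  assume "monic_fun m (\<lambda>_. \<zero>)"
  then obtain p where p: "set p \<subseteq> carrier R" "length p \<le> m"
      "\<forall>x\<in>carrier R. \<zero> = x [^] m \<oplus> eval p x"
    unfolding monic_fun_def by blast
  let ?q = "normalize (map (\<lambda>c. \<ominus> c) p)"
  have c: "set (map (\<lambda>c. \<ominus> c) p) \<subseteq> carrier R" using p(1) by auto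
  have "?q \<in> carrier (univ_poly R (carrier R))"
    unfolding univ_poly_carrier[symmetric] using normalize_gives_polynomial[OF c] .
  moreover have "degree ?q < m"
    using normalize_length_le[of "map (\<lambda>c. \<ominus> c) p"] p(2) assms by simp
  moreover have "eval ?q x = x [^] m" if x: "x \<in> carrier R" for x
  proof -
    have "x [^] m \<oplus> eval p x = \<zero>" using p(3) x by simp
    then have "x [^] m = \<ominus> eval p x"
      using minus_equality[of "x [^] m" "eval p x"] x eval_in_carrier[OF p(1) x] by simp
    then show ?thesis
      using eval_normalize[OF c x] eval_map_uminus[OF p(1) x] by simp
  qed
  ultimately show "reduces_power R m"
    unfolding reduces_power_def by blast
qed

lemma (in ring) monic_fun_cong:
  assumes "monic_fun d f" "\<And>x. x \<in> carrier R \<Longrightarrow> f x = g x"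
  shows "monic_fun d g"
  using assms unfolding monic_fun_def by metis

lemma (in cring) monic_fun_one: "monic_fun 0 (\<lambda>_. \<one>)"
  unfolding monic_fun_def by (intro exI[of _ "[]"]) simp

lemma (in cring) monic_fun_linear_mult:
  assumes "monic_fun d f" and r: "r \<in> carrier R"
  shows "monic_fun (Suc d) (\<lambda>x. (x \<ominus> r) \<otimes> f x)"
proof -
  obtain p where p: "set p \<subseteq> carrier R" "length p = d"
      "\<forall>x\<in>carrier R. f x = x [^] d \<oplus> eval p x"
    using assms(1) by (rule monic_funE)
  define s where "s = \<one> # p"
  have s: "set s \<subseteq> carrier R" "length s = Suc d"
    using p(1,2) unfolding s_def by auto
  have eval_s: "eval s x = x [^] d \<oplus> eval p x" if "x \<in> carrier R" for x
    using p(1,2) that unfolding s_def by simp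
  \<comment> \<open>The lower-order part of the product is \<open>X p\<close> plus \<open>-r\<close> times the monic polynomial \<open>s\<close>.\<close>
  let ?u = "p @ [\<zero>]" and ?v = "poly_mult [\<ominus> r] s"
  have u: "set ?u \<subseteq> carrier R" using p(1) by simp
  \<comment> \<open>The recursion equation of \<open>poly_add\<close> swaps its arguments and loops as a rewrite rule.\<close>
  have v: "set ?v \<subseteq> carrier R" using poly_mult_in_carrier[OF _ s(1), of "[\<ominus> r]"] r
    by (simp del: poly_add.simps poly_mult.simps)
  have len_v: "length ?v \<le> Suc d"
    using poly_add_length_le[of "map ((\<otimes>) (\<ominus> r)) s" "[]"] s(2) by (simp del: poly_add.simps)
  have "length (poly_add ?u ?v) \<le> Suc d"
    using poly_add_length_le[of ?u ?v] len_v p(2) by (simp del: poly_add.simps poly_mult.simps)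
  moreover have "set (poly_add ?u ?v) \<subseteq> carrier R"
    using poly_add_in_carrier[OF u v] .
  moreover have "(x \<ominus> r) \<otimes> f x = x [^] Suc d \<oplus> eval (poly_add ?u ?v) x"
    if x: "x \<in> carrier R" for x
  proof -
    have e: "eval p x \<in> carrier R" using eval_in_carrier[OF p(1) x] .
    have "eval ?u x = eval p x \<otimes> x"
      using eval_append_aux[OF p(1) zero_closed x] e x by simp
    moreover have "eval ?v x = \<ominus> r \<otimes> (x [^] d \<oplus> eval p x)"
      using eval_poly_mult[OF _ s(1) x, of "[\<ominus> r]"] eval_s[OF x] r x
      by (simp del: poly_add.simps poly_mult.simps)
    ultimately have ev: "eval (poly_add ?u ?v) x =
        eval p x \<otimes> x \<oplus> \<ominus> r \<otimes> (x [^] d \<oplus> eval p x)"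
      using eval_poly_add[OF u v x] by (simp only:)
    have "(x \<ominus> r) \<otimes> (y \<oplus> z) = y \<otimes> x \<oplus> (z \<otimes> x \<oplus> \<ominus> r \<otimes> (y \<oplus> z))"
      if "y \<in> carrier R" "z \<in> carrier R" for y z
      using that x r by algebra
    from this[OF nat_pow_closed[OF x, of d] e]
    show ?thesis using p(3) x unfolding ev by simp
  qed
  ultimately show ?thesis
    unfolding monic_fun_def by blast
qed

lemma (in cring) monic_fun_finprod_mult:
  assumes "finite S" "S \<subseteq> carrier R" and f: "monic_fun d f" "\<And>x. x \<in> carrier R \<Longrightarrow> f x \<in> carrier R"
  shows "monic_fun (card S + d) (\<lambda>x. (\<Otimes>r\<in>S. x \<ominus> r) \<otimes> f x)"
  using assms(1,2)
proof (induction S)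
  case empty
  show ?case using monic_fun_cong[OF f(1), of "\<lambda>x. (\<Otimes>r\<in>{}. x \<ominus> r) \<otimes> f x"] f(2) by simp
next
  case (insert r S)
  have "monic_fun (Suc (card S + d)) (\<lambda>x. (x \<ominus> r) \<otimes> ((\<Otimes>r\<in>S. x \<ominus> r) \<otimes> f x))"
    using insert by (intro monic_fun_linear_mult) auto
  then have "monic_fun (Suc (card S + d)) (\<lambda>x. (\<Otimes>r\<in>insert r S. x \<ominus> r) \<otimes> f x)"
  proof (rule monic_fun_cong)
    fix x assume x: "x \<in> carrier R"
    have "(\<lambda>r. x \<ominus> r) \<in> S \<rightarrow> carrier R" using insert x by auto
    then show "(x \<ominus> r) \<otimes> ((\<Otimes>r\<in>S. x \<ominus> r) \<otimes> f x) = (\<Otimes>r\<in>insert r S. x \<ominus> r) \<otimes> f x"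
      using insert x f(2) by (simp add: m_assoc)
  qed
  then show ?case using insert by simp
qed

lemma (in cring) reduces_power_mono:
  assumes "reduces_power R k" "0 < k" "k \<le> m"
  shows "reduces_power R m"
  using assms(3,1)
proof (induction m rule: dec_induct)
  case (step m)
  then have "monic_fun m (\<lambda>_. \<zero>)"
    using assms(2) by (simp add: reduces_power_iff_monic_fun)
  from monic_fun_linear_mult[OF this zero_closed] have "monic_fun (Suc m) (\<lambda>_. \<zero>)"
    by (rule monic_fun_cong) simp
  then show ?case by (simp add: reduces_power_iff_monic_fun)
qed

section \<open>Vanishing polynomials from ideals with zero product\<close>

lemma (in ideal) coset_representatives:
  assumes "finite (carrier R)"
  obtains S where "S \<subseteq> carrier R" "card S \<le> card (a_rcosets I)"
    "\<And>x. x \<in> carrier R \<Longrightarrow> \<exists>r\<in>S. x \<ominus> r \<in> I"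
proof
  let ?S = "(\<lambda>C. SOME x. x \<in> C) ` (a_rcosets I)"
  have rep: "(SOME y. y \<in> I +> x) \<in> I +> x" if "x \<in> carrier R" for x
    using a_rcos_self[OF that] by (metis someI_ex)
  have sub: "I +> x \<subseteq> carrier R" if "x \<in> carrier R" for x
    using a_r_coset_subset_G[OF a_subset that] .
  show "?S \<subseteq> carrier R"
    using rep sub unfolding A_RCOSETS_def' by blast
  have "a_rcosets I \<subseteq> Pow (carrier R)"
    using sub unfolding A_RCOSETS_def' by blast
  then show "card ?S \<le> card (a_rcosets I)"
    using assms by (meson card_image_le finite_Pow_iff finite_subset)
  fix x assume x: "x \<in> carrier R"
  let ?r = "SOME y. y \<in> I +> x"
  have r: "?r \<in> carrier R" using rep[OF x] sub[OF x] by blast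
  have "I +> x = I +> ?r"
    using a_repr_independence'[OF rep[OF x] x] by simp
  then have "x \<in> I +> ?r" using a_rcos_self[OF x] by simp
  then have "x \<ominus> ?r \<in> I"
    using a_rcos_module_minus[OF ring_axioms r x] by simp
  moreover have "?r \<in> ?S"
    using x unfolding A_RCOSETS_def' by blast
  ultimately show "\<exists>r\<in>?S. x \<ominus> r \<in> I" by blast
qed

lemma (in ideal) finprod_mem:
  assumes "cring R" "finite S" "f \<in> S \<rightarrow> carrier R" "r \<in> S" "f r \<in> I"
  shows "(\<Otimes>s\<in>S. f s) \<in> I"
proof -
  interpret cring R by fact
  have "finprod R f S = finprod R f (insert r (S - {r}))"
    using assms(4) by (simp add: insert_absorb)
  also have "\<dots> = f r \<otimes> finprod R f (S - {r})"
    using assms by (intro finprod_insert) auto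
  also have "\<dots> \<in> I"
    using assms by (intro I_r_closed finprod_closed) auto
  finally show ?thesis .
qed

text \<open>At every \<open>x\<close> the product over representatives modulo \<open>I\<close> has a factor in \<open>I\<close>, and the one
  modulo \<open>J\<close> a factor in \<open>J\<close>. For \<open>R = \<int>\<^sub>2 \<times> \<int>\<^sub>2\<close> and its two proper factors this only gives degree
  four, so the bound need not be the least possible degree.\<close>

lemma (in cring) reduces_power_index_add:
  assumes fin: "finite (carrier R)" and I: "ideal I R" and J: "ideal J R"
    and zero: "\<And>i j. i \<in> I \<Longrightarrow> j \<in> J \<Longrightarrow> i \<otimes> j = \<zero>"
  shows "reduces_power R (card (a_rcosets I) + card (a_rcosets J))"
proof -
  obtain S where S: "S \<subseteq> carrier R" "card S \<le> card (a_rcosets I)"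
      "\<And>x. x \<in> carrier R \<Longrightarrow> \<exists>r\<in>S. x \<ominus> r \<in> I"
    using ideal.coset_representatives[OF I fin] by metis
  obtain T where T: "T \<subseteq> carrier R" "card T \<le> card (a_rcosets J)"
      "\<And>x. x \<in> carrier R \<Longrightarrow> \<exists>r\<in>T. x \<ominus> r \<in> J"
    using ideal.coset_representatives[OF J fin] by metis
  have finS: "finite S" "finite T" using S(1) T(1) fin finite_subset by auto
  have "monic_fun (card T + 0) (\<lambda>x. (\<Otimes>r\<in>T. x \<ominus> r) \<otimes> \<one>)"
    using finS T(1) monic_fun_one by (intro monic_fun_finprod_mult) auto
  moreover have clT: "(\<Otimes>r\<in>T. x \<ominus> r) \<in> carrier R" if "x \<in> carrier R" for x
    using T(1) that by (intro finprod_closed) auto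
  ultimately have "monic_fun (card S + card T) (\<lambda>x. (\<Otimes>r\<in>S. x \<ominus> r) \<otimes> ((\<Otimes>r\<in>T. x \<ominus> r) \<otimes> \<one>))"
    using finS S(1) by (intro monic_fun_finprod_mult) auto
  then have "monic_fun (card S + card T) (\<lambda>_. \<zero>)"
  proof (rule monic_fun_cong)
    fix x assume x: "x \<in> carrier R"
    obtain r t where "r \<in> S" "x \<ominus> r \<in> I" "t \<in> T" "x \<ominus> t \<in> J"
      using S(3) T(3) x by blast
    then have "(\<Otimes>r\<in>S. x \<ominus> r) \<in> I" "(\<Otimes>r\<in>T. x \<ominus> r) \<in> J"
      using ideal.finprod_mem[OF I cring_axioms finS(1), of "\<lambda>r. x \<ominus> r" r]
        ideal.finprod_mem[OF J cring_axioms finS(2), of "\<lambda>r. x \<ominus> r" t] S(1) T(1) x by auto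
    then show "(\<Otimes>r\<in>S. x \<ominus> r) \<otimes> ((\<Otimes>r\<in>T. x \<ominus> r) \<otimes> \<one>) = \<zero>"
      using zero clT[OF x] by simp
  qed
  moreover have "card S > 0"
    using S(3)[OF zero_closed] finS by (auto simp: card_gt_0_iff)
  ultimately show ?thesis
    using S(2) T(2) reduces_power_mono[of "card S + card T"]
    by (simp add: reduces_power_iff_monic_fun)
qed

lemma (in cring) reduces_power_card:
  assumes "finite (carrier R)"
  shows "reduces_power R (card (carrier R))"
proof -
  have "monic_fun (card (carrier R) + 0) (\<lambda>x. (\<Otimes>r\<in>carrier R. x \<ominus> r) \<otimes> \<one>)"
    using assms monic_fun_one by (intro monic_fun_finprod_mult) auto
  then have "monic_fun (card (carrier R) + 0) (\<lambda>_. \<zero>)"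
  proof (rule monic_fun_cong)
    fix x assume x: "x \<in> carrier R"
    have "(\<Otimes>r\<in>carrier R. x \<ominus> r) \<in> {\<zero>}"
      using ideal.finprod_mem[OF zeroideal cring_axioms assms, of "\<lambda>r. x \<ominus> r" x] x
      by (auto simp: minus_eq r_neg)
    then show "(\<Otimes>r\<in>carrier R. x \<ominus> r) \<otimes> \<one> = \<zero>" by simp
  qed
  moreover have "card (carrier R) > 0"
    using assms by (auto simp: card_gt_0_iff)
  ultimately show ?thesis by (simp add: reduces_power_iff_monic_fun)
qed

lemma (in cring) ring_s_eq_card_iff:
  assumes fin: "finite (carrier R)" and "\<one> \<noteq> \<zero>"
  shows "ring_s R = enat (card (carrier R)) \<longleftrightarrow> \<not> reduces_power R (card (carrier R) - 1)"
proof -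
  let ?n = "card (carrier R)" and ?P = "\<lambda>m. m > 0 \<and> reduces_power R m"
  have "card {\<zero>, \<one>} \<le> ?n" by (intro card_mono fin) auto
  then have n: "?n \<ge> 2" using assms(2) by auto
  have P: "?P ?n" using reduces_power_card[OF fin] n by simp
  then have s: "ring_s R = enat (LEAST m. ?P m)" unfolding ring_s_def by auto
  show ?thesis
  proof
    assume "ring_s R = enat ?n"
    then have "?n - 1 < (LEAST m. ?P m)" using s n by simp
    then show "\<not> reduces_power R (?n - 1)" using not_less_Least n by fastforce
  next
    assume a: "\<not> reduces_power R (?n - 1)"
    have "(LEAST m. ?P m) = ?n"
    proof (rule Least_equality[where P = ?P])
      show "?P ?n" by (fact P)
      fix m assume m: "?P m"
      then have "\<not> m \<le> ?n - 1" using reduces_power_mono a by blast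
      then show "?n \<le> m" by linarith
    qed
    then show "ring_s R = enat ?n" using s by simp
  qed
qed

section \<open>Rings that attain the bound\<close>

lemma (in field) not_reduces_power_field:
  assumes fin: "finite (carrier R)" and m: "m < card (carrier R)" "m > 0"
  shows "\<not> reduces_power R m"
proof
  assume "reduces_power R m"
  then obtain p where p: "set p \<subseteq> carrier R" "length p = m"
      "\<forall>x\<in>carrier R. \<zero> = x [^] m \<oplus> eval p x"
    unfolding reduces_power_iff_monic_fun[OF m(2)] by (rule monic_funE)
  let ?q = "\<one> # p"
  have "polynomial (carrier R) ?q"
    using p(1) unfolding polynomial_def by auto
  then have q: "?q \<in> carrier (poly_ring R)" unfolding univ_poly_carrier .
  have "eval ?q x = \<zero>" if x: "x \<in> carrier R" for x
    using p(3)[rule_format, OF x, symmetric] p(2) x by simp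
  then have "is_root ?q x" if "x \<in> carrier R" for x
    using that unfolding is_root_def by blast
  then have "carrier R \<subseteq> set_mset (roots ?q)"
    using roots_mem_iff_is_root[OF q] by blast
  then have "card (carrier R) \<le> card (set_mset (roots ?q))"
    by (intro card_mono) auto
  also have "\<dots> \<le> size (roots ?q)"
    by (metis card_mono finite_set_mset size_multiset_overloaded_eq sum_mono card_eq_sum One_nat_def Suc_leI
        count_greater_zero_iff)
  also have "\<dots> \<le> degree ?q" using size_roots_le_degree[OF q] .
  also have "\<dots> = m" using p(2) by simp
  finally show False using m(1) by simp
qed

text \<open>If \<open>f = X\<^sup>3 + c X\<^sup>2 + d X + e\<close> vanished, its roots \<open>0\<close> and \<open>a\<close> would give \<open>e = 0\<close> and
  \<open>d a = 0\<close>. Since \<open>1 + a\<close> is an involution, \<open>f(1 + a)\<close> and \<open>f(1)\<close> then differ only in the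
  cubic term, by \<open>a\<close>.\<close>

lemma (in cring) not_reduces_power_three:
  assumes a: "a \<in> carrier R" "a \<noteq> \<zero>" "a \<otimes> a = \<zero>" "a \<oplus> a = \<zero>"
  shows "\<not> reduces_power R 3"
proof
  assume "reduces_power R 3"
  then obtain p where p: "set p \<subseteq> carrier R" "length p = 3"
      "\<forall>x\<in>carrier R. \<zero> = x [^] (3::nat) \<oplus> eval p x"
    unfolding reduces_power_iff_monic_fun[OF zero_less_numeral] by (rule monic_funE)
  obtain c d e where q: "p = [c, d, e]"
    using p(2) by (auto simp: numeral_3_eq_3 length_Suc_conv)
  then have cde: "c \<in> carrier R" "d \<in> carrier R" "e \<in> carrier R" using p(1) by auto
  define f where "f x = x \<otimes> x \<otimes> x \<oplus> (c \<otimes> (x \<otimes> x) \<oplus> (d \<otimes> x \<oplus> e))" for x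
  have f: "f x = \<zero>" if x: "x \<in> carrier R" for x
  proof -
    have "x [^] (2::nat) = x \<otimes> x" using x by (simp add: numeral_2_eq_2)
    then have "eval p x = c \<otimes> (x \<otimes> x) \<oplus> (d \<otimes> x \<oplus> e)"
      using x cde unfolding q by simp
    then show ?thesis
      using p(3)[rule_format, OF x, symmetric] x unfolding f_def by (simp add: numeral_3_eq_3)
  qed
  have sq: "(\<one> \<oplus> a) \<otimes> (\<one> \<oplus> a) = \<one>"
  proof -
    have "(\<one> \<oplus> a) \<otimes> (\<one> \<oplus> a) = \<one> \<oplus> (a \<oplus> a) \<oplus> a \<otimes> a" using a(1) by algebra
    then show ?thesis using a by simp
  qed
  have "e = \<zero>" using f[of \<zero>] cde unfolding f_def by simp
  moreover from this have "d \<otimes> a = \<zero>" using f[of a] a cde unfolding f_def by simp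
  ultimately have "f (\<one> \<oplus> a) = (\<one> \<oplus> a) \<oplus> (c \<oplus> d)" "f \<one> = \<one> \<oplus> (c \<oplus> d)"
    using a(1) cde sq unfolding f_def by (simp_all add: r_distr)
  then have "(\<one> \<oplus> a) \<oplus> (c \<oplus> d) = \<one> \<oplus> (c \<oplus> d)"
    using f[of "\<one> \<oplus> a"] f[of \<one>] a(1) by simp
  then have "\<one> \<oplus> a = \<one> \<oplus> \<zero>" using a(1) cde by simp
  then have "a = \<zero>" using a(1) by (simp del: r_zero)
  then show False using a(2) by simp
qed

section \<open>The structure of the remaining rings\<close>

lemma (in cring) annihilator_ideal:
  assumes a: "a \<in> carrier R"
  shows "ideal {x \<in> carrier R. a \<otimes> x = \<zero>} R"
proof (rule idealI[OF ring_axioms])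
  show "subgroup {x \<in> carrier R. a \<otimes> x = \<zero>} (add_monoid R)"
  proof (rule add.subgroupI)
    fix x y assume "x \<in> {x \<in> carrier R. a \<otimes> x = \<zero>}" "y \<in> {x \<in> carrier R. a \<otimes> x = \<zero>}"
    then show "x \<oplus> y \<in> {x \<in> carrier R. a \<otimes> x = \<zero>}" using a by (simp add: r_distr)
  next
    fix x assume "x \<in> {x \<in> carrier R. a \<otimes> x = \<zero>}"
    then show "\<ominus> x \<in> {x \<in> carrier R. a \<otimes> x = \<zero>}" using a by (simp add: r_minus)
  qed (use a in auto)
next
  fix x y assume *: "x \<in> {x \<in> carrier R. a \<otimes> x = \<zero>}" "y \<in> carrier R"
  then have "a \<otimes> (x \<otimes> y) = \<zero>" using a by (simp add: m_assoc[symmetric])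
  then show "x \<otimes> y \<in> {x \<in> carrier R. a \<otimes> x = \<zero>}" "y \<otimes> x \<in> {x \<in> carrier R. a \<otimes> x = \<zero>}"
    using * by (simp_all add: m_comm)
qed

lemma (in cring) finite_nonunit_zero_divisor:
  assumes fin: "finite (carrier R)" and a: "a \<in> carrier R"
    and nonunit: "\<And>x. x \<in> carrier R \<Longrightarrow> a \<otimes> x \<noteq> \<one>"
  obtains b where "b \<in> carrier R" "b \<noteq> \<zero>" "a \<otimes> b = \<zero>"
proof -
  have "(\<lambda>x. a \<otimes> x) ` carrier R \<subseteq> carrier R" using a by auto
  moreover have "\<one> \<notin> (\<lambda>x. a \<otimes> x) ` carrier R" using nonunit by force
  ultimately have "\<not> inj_on (\<lambda>x. a \<otimes> x) (carrier R)"
    using endo_inj_surj[OF fin] one_closed by blast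
  then obtain x y where xy: "x \<in> carrier R" "y \<in> carrier R" "a \<otimes> x = a \<otimes> y" "x \<noteq> y"
    unfolding inj_on_def by blast
  have "a \<otimes> (x \<ominus> y) = a \<otimes> x \<ominus> a \<otimes> y" using a xy by algebra
  then have "a \<otimes> (x \<ominus> y) = \<zero>" using a xy by (simp add: minus_eq r_neg)
  moreover have "x \<ominus> y \<noteq> \<zero>" using xy r_right_minus_eq by simp
  ultimately show thesis using that[of "x \<ominus> y"] xy by simp
qed

lemma (in cring) reduces_power_two_if_boolean:
  assumes "\<one> \<noteq> \<zero>" "\<And>x. x \<in> carrier R \<Longrightarrow> x \<otimes> x = x"
  shows "reduces_power R 2"
proof -
  have "[\<one>, \<zero>] \<in> carrier (univ_poly R (carrier R))"
    unfolding univ_poly_carrier[symmetric] polynomial_def using assms(1) by simp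
  moreover have "eval [\<one>, \<zero>] x = x [^] (2::nat)" if "x \<in> carrier R" for x
    using that assms(2) by (simp add: numeral_2_eq_2)
  ultimately show ?thesis unfolding reduces_power_def by (intro bexI[of _ "[\<one>, \<zero>]"]) auto
qed

text \<open>The indices of \<open>I = Ra\<close> and \<open>J = Ann a\<close> are at most \<open>n/2\<close> each but sum to at least \<open>n\<close>, so
  both equal \<open>n/2\<close>. A generator \<open>c\<close> of \<open>J = {0, c}\<close> then determines the whole ring as
  \<open>{0, 1, c, 1 + c}\<close>; this is used for any available \<open>c\<close>: first an arbitrary one to count, then
  \<open>1 - a\<close> if \<open>a\<close> is idempotent, and finally \<open>a\<close> itself.\<close>

lemma (in cring) nonfield_structure:
  assumes fin: "finite (carrier R)" and one: "\<one> \<noteq> \<zero>" and nonfield: "\<not> field R"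
    and nred: "\<not> reduces_power R (card (carrier R) - 1)"
  obtains a where "a \<in> carrier R" "a \<noteq> \<zero>" "a \<otimes> a = \<zero>" "a \<oplus> a = \<zero>"
    "carrier R = {\<zero>, \<one>, a, \<one> \<oplus> a}" "card (carrier R) = 4"
proof -
  obtain a where a: "a \<in> carrier R" "a \<noteq> \<zero>" and nonunit: "\<And>x. x \<in> carrier R \<Longrightarrow> a \<otimes> x \<noteq> \<one>"
    using cring_fieldI2 one nonfield by metis
  obtain b where b: "b \<in> carrier R" "b \<noteq> \<zero>" "a \<otimes> b = \<zero>"
    using finite_nonunit_zero_divisor[OF fin a(1) nonunit] by blast
  let ?n = "card (carrier R)"
  define I where "I = PIdl a"
  define J where "J = {x \<in> carrier R. a \<otimes> x = \<zero>}"
  have I: "ideal I R" and J: "ideal J R"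
    unfolding I_def J_def using cgenideal_ideal[OF a(1)] annihilator_ideal[OF a(1)] .
  have I_iff: "y \<in> I \<longleftrightarrow> (\<exists>x\<in>carrier R. y = x \<otimes> a)" for y
    unfolding I_def cgenideal_def by auto
  have "i \<otimes> j = \<zero>" if ij: "i \<in> I" "j \<in> J" for i j
  proof -
    obtain x where x: "x \<in> carrier R" "i = x \<otimes> a" using ij(1) I_iff by blast
    then show ?thesis using ij(2) a(1) by (simp add: J_def m_assoc)
  qed
  from reduces_power_index_add[OF fin I J this]
  have red: "reduces_power R (card (a_rcosets I) + card (a_rcosets J))" .
  have aI: "a \<in> I" using I_iff[of a] a(1) by (auto intro!: bexI[of _ \<one>])
  have zI: "\<zero> \<in> I" using I additive_subgroup.zero_closed ideal.axioms(1) by blast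
  have finIJ: "finite I" "finite J"
    using fin ideal.axioms(1)[OF I] unfolding J_def
    by (auto intro: finite_subset dest: additive_subgroup.a_subset)
  have "card {\<zero>, a} \<le> card I" by (rule card_mono) (use finIJ aI zI in auto)
  then have cI: "card I \<ge> 2" using a by auto
  have "card {\<zero>, b} \<le> card J" by (rule card_mono) (use finIJ b a in \<open>auto simp: J_def\<close>)
  then have cJ: "card J \<ge> 2" using b by auto
  have lI: "card (a_rcosets I) * card I = ?n" and lJ: "card (a_rcosets J) * card J = ?n"
    using a_lagrange[OF fin ideal.axioms(1)[OF I]] a_lagrange[OF fin ideal.axioms(1)[OF J]]
    by (simp_all add: order_def)
  have "a \<noteq> \<one>" using nonunit[of \<one>] a by auto
  then have "card {\<zero>, \<one>, a} = 3" using a one by auto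
  moreover have "card {\<zero>, \<one>, a} \<le> ?n" by (rule card_mono) (use fin a in auto)
  ultimately have n3: "?n \<ge> 3" by simp
  have pos: "card (a_rcosets I) > 0" "card (a_rcosets J) > 0"
    using lI lJ n3 by (auto intro!: Nat.gr0I)
  have "\<not> card (a_rcosets I) + card (a_rcosets J) \<le> ?n - 1"
    using reduces_power_mono[OF red] pos nred by auto
  moreover have "card (a_rcosets I) * 2 \<le> ?n" "card (a_rcosets J) * 2 \<le> ?n"
    using mult_le_mono2[OF cI, of "card (a_rcosets I)"] mult_le_mono2[OF cJ, of "card (a_rcosets J)"]
      lI lJ by simp_all
  ultimately have idx: "card (a_rcosets I) * 2 = ?n" "card (a_rcosets J) * 2 = ?n" by linarith+
  then have "card I = 2" "card J = 2" using lI lJ pos by (metis mult_left_cancel less_not_refl)+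
  then have I_eq: "I = {\<zero>, a}"
    using card_subset_eq[OF finIJ(1), of "{\<zero>, a}"] aI zI a by auto
  have J_eq: "J = {\<zero>, c}" if "c \<in> J" "c \<noteq> \<zero>" for c
    using card_subset_eq[OF finIJ(2), of "{\<zero>, c}"] \<open>card J = 2\<close> that a(1) by (auto simp: J_def)
  \<comment> \<open>Each \<open>x\<close> satisfies \<open>a x = 0\<close> or \<open>a x = a\<close>, so \<open>x\<close> or \<open>x - 1\<close> lies in \<open>J\<close>.\<close>
  have R_eq: "carrier R = {\<zero>, \<one>, c, \<one> \<oplus> c}" if c: "c \<in> J" "c \<noteq> \<zero>" for c
  proof
    have c': "c \<in> carrier R" using c by (simp add: J_def)
    show "{\<zero>, \<one>, c, \<one> \<oplus> c} \<subseteq> carrier R" using c' by auto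
    show "carrier R \<subseteq> {\<zero>, \<one>, c, \<one> \<oplus> c}"
    proof
      fix x assume x: "x \<in> carrier R"
      have "x \<otimes> a \<in> {\<zero>, a}" using I_iff x I_eq by blast
      then have "a \<otimes> x = \<zero> \<or> a \<otimes> (x \<ominus> \<one>) = \<zero>"
      proof
        assume "x \<otimes> a \<in> {a}"
        then have "a \<otimes> x = a" using a x by (simp add: m_comm)
        moreover have "a \<otimes> (x \<ominus> \<one>) = a \<otimes> x \<ominus> a" using a x by algebra
        ultimately show ?thesis using a by (simp add: minus_eq r_neg)
      qed (use a x in \<open>simp add: m_comm\<close>)
      then have "x \<in> J \<or> x \<ominus> \<one> \<in> J"
        using x unfolding J_def by simp
      then consider "x \<in> {\<zero>, c}" | "x \<ominus> \<one> \<in> {\<zero>, c}"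
        unfolding J_eq[OF c] by blast
      then show "x \<in> {\<zero>, \<one>, c, \<one> \<oplus> c}"
      proof cases
        case 2
        have "\<one> \<oplus> (x \<ominus> \<one>) = x" using x by algebra
        then have "\<one> \<oplus> \<zero> = x \<or> \<one> \<oplus> c = x" using 2 by (metis insertE singletonD)
        then show ?thesis by auto
      qed auto
    qed
  qed
  have "b \<in> J" using b by (simp add: J_def)
  then have "?n = card {\<zero>, \<one>, b, \<one> \<oplus> b}" using R_eq b(2) by simp
  also have "\<dots> \<le> 4" by (simp add: card_insert_if)
  finally have "?n \<le> 4" .
  \<comment> \<open>The order is even because \<open>I\<close> has index \<open>n/2\<close>.\<close>
  then have n4: "?n = 4" using n3 idx by presburger
  have aa: "a \<otimes> a = \<zero>"
  proof (rule ccontr)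
    assume "a \<otimes> a \<noteq> \<zero>"
    then have idem: "a \<otimes> a = a" using I_iff[of "a \<otimes> a"] a I_eq by auto
    define c where "c = \<one> \<ominus> a"
    have c: "c \<in> carrier R" using a unfolding c_def by simp
    have "a \<otimes> c = a \<ominus> a \<otimes> a" using a(1) unfolding c_def by algebra
    then have ac: "a \<otimes> c = \<zero>" using idem a by (simp add: minus_eq r_neg)
    have c0: "c \<noteq> \<zero>" using \<open>a \<noteq> \<one>\<close> a r_right_minus_eq unfolding c_def by auto
    have "c \<otimes> c = c \<ominus> a \<otimes> c" using a(1) unfolding c_def by algebra
    then have cc: "c \<otimes> c = c" using ac c by (simp add: minus_eq)
    have "c \<in> J" using ac c by (simp add: J_def)
    from R_eq[OF this c0] have R: "carrier R = {\<zero>, \<one>, c, \<one> \<oplus> c}" .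
    have "a \<noteq> c" using ac idem a(2) by metis
    moreover have "a \<in> {\<zero>, \<one>, c, \<one> \<oplus> c}" using a(1) unfolding R .
    ultimately have "\<one> \<oplus> c = a" using a(2) \<open>a \<noteq> \<one>\<close> by simp
    then have R': "carrier R = {\<zero>, \<one>, c, a}" unfolding R by simp
    have "x \<otimes> x = x" if x: "x \<in> carrier R" for x
    proof -
      have "x \<in> {\<zero>, \<one>, c, a}" using x unfolding R' .
      then show ?thesis using idem cc by auto
    qed
    from reduces_power_two_if_boolean[OF one this] have "reduces_power R 3"
      using reduces_power_mono[of 2 3] by simp
    then show False using nred n4 by simp
  qed
  have "(\<one> \<oplus> \<one>) \<otimes> a = a \<oplus> a" using a(1) by algebra
  then have "a \<oplus> a \<in> I" unfolding I_iff using one_closed a_closed by metis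
  then have "a \<oplus> a = \<zero> \<or> a \<oplus> a = a" unfolding I_eq by simp
  then have two: "a \<oplus> a = \<zero>" using a by auto
  have aJ: "a \<in> J" using a(1) aa by (simp add: J_def)
  show thesis
    by (rule that[OF a aa two R_eq[OF aJ a(2)] n4])
qed

section \<open>Recognizing the integers modulo four\<close>

text \<open>The canonical map \<open>k \<mapsto> k \<cdot> 1\<close> from the integers is onto with kernel \<open>4\<int>\<close>: as \<open>4 \<cdot> 1 = 0\<close> it
  only depends on \<open>k\<close> modulo four, and the four multiples of \<open>1\<close> are distinct by counting.\<close>

lemma (in ring) iso_ZFact_four:
  assumes R: "carrier R = {\<zero>, \<one>, \<one> \<oplus> \<one>, \<one> \<oplus> (\<one> \<oplus> \<one>)}" and "card (carrier R) = 4"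
    and four: "(\<one> \<oplus> \<one>) \<oplus> (\<one> \<oplus> \<one>) = \<zero>"
  shows "R \<simeq> ZFact 4"
proof -
  define h :: "int \<Rightarrow> 'a" where "h k = [k] \<cdot> \<one>" for k
  have hc: "h k \<in> carrier R" for k unfolding h_def by simp
  have add: "h (k + l) = h k \<oplus> h l" for k l
    unfolding h_def by (simp add: add.int_pow_mult)
  have mult: "h (k * l) = h k \<otimes> h l" for k l
    unfolding h_def by (simp add: add_pow_ldistr_int add.int_pow_pow mult.commute)
  have h0: "h 0 = \<zero>" unfolding h_def by (simp add: add_pow_def)
  have h1: "h 1 = \<one>" unfolding h_def by (simp add: add.int_pow_1)
  have h2: "h 2 = \<one> \<oplus> \<one>" using add[of 1 1] h1 by simp
  have h3: "h 3 = \<one> \<oplus> (\<one> \<oplus> \<one>)" using add[of 1 2] h1 h2 by simp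
  have h4: "h 4 = \<zero>" using add[of 2 2] h2 four by simp
  interpret hom: ring_hom_ring \<Z> R h
    by (rule ring_hom_ringI) (use int.ring_axioms ring_axioms hc add mult h1 in auto)
  have mod: "h k = h (k mod 4)" for k
  proof -
    have "h k = h (4 * (k div 4) + k mod 4)" by simp
    also have "\<dots> = h (k mod 4)" unfolding add mult h4 using hc by simp
    finally show ?thesis .
  qed
  have ne: "h 1 \<noteq> \<zero>" "h 2 \<noteq> \<zero>" "h 3 \<noteq> \<zero>"
    using assms(2) unfolding R h1 h2 h3 by (auto simp: card_insert_if split: if_splits)
  have "h k = \<zero> \<longleftrightarrow> 4 dvd k" for k
  proof
    assume "h k = \<zero>"
    then have "h (k mod 4) = \<zero>" using mod by metis
    moreover have "k mod 4 = 0 \<or> k mod 4 = 1 \<or> k mod 4 = 2 \<or> k mod 4 = 3" by presburger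
    ultimately show "4 dvd k" using ne by auto
  next
    assume "4 dvd k"
    then show "h k = \<zero>" using mod[of k] h0 by simp
  qed
  then have "a_kernel \<Z> R h = Idl\<^bsub>\<Z>\<^esub> {4}"
    unfolding a_kernel_def' int_Idl by (auto simp: dvd_def mult.commute)
  moreover have "h ` carrier \<Z> = carrier R"
  proof
    show "h ` carrier \<Z> \<subseteq> carrier R" using hc by auto
    have "h ` {0, 1, 2, 3} \<subseteq> h ` carrier \<Z>" by (intro image_mono) simp
    then show "carrier R \<subseteq> h ` carrier \<Z>"
      unfolding R image_insert image_empty h0 h1 h2 h3 .
  qed
  ultimately have "ZFact 4 \<simeq> R"
    using hom.FactRing_iso unfolding ZFact_def by simp
  then show ?thesis
    using ring_iso_sym cring.axioms(1)[OF ZFact_is_cring] by blast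
qed

lemma card_ZFact_four: "card (carrier (ZFact 4)) = 4"
proof -
  have "carrier (ZFact 4) = range (ZMod 4)"
    unfolding ZFact_def FactRing_def ZMod_def A_RCOSETS_def' by auto
  also have "\<dots> = ZMod 4 ` {0..<4}"
    by (auto simp: image_iff) (metis ZMod_mod atLeastLessThan_iff pos_mod_bound pos_mod_sign zero_less_numeral)
  also have "card \<dots> = 4"
    by (subst card_image) (auto simp: inj_on_def ZMod_eq_mod)
  finally show ?thesis .
qed

text \<open>The witness is \<open>1 + 1\<close>, which every isomorphism maps to the class of \<open>2\<close>.\<close>

lemma (in ring) ZFact_four_nilpotent:
  assumes "R \<simeq> ZFact 4"
  obtains a where "a \<in> carrier R" "a \<noteq> \<zero>" "a \<otimes> a = \<zero>" "a \<oplus> a = \<zero>"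
proof
  interpret Z: cring "ZFact 4" by (rule ZFact_is_cring)
  obtain f where f: "f \<in> ring_iso R (ZFact 4)"
    using assms unfolding is_ring_iso_def by blast
  then have fhom: "f \<in> ring_hom R (ZFact 4)" and inj: "inj_on f (carrier R)"
    unfolding ring_iso_def bij_betw_def by auto
  have chom: "ZMod 4 \<in> ring_hom \<Z> (ZFact 4)"
    using ideal.rcos_ring_hom[OF int.genideal_ideal[of "{4}"]]
    unfolding ZFact_def ZMod_def by simp
  have f0: "f \<zero> = ZMod 4 0"
    using ring_hom_zero[OF fhom ring_axioms Z.ring_axioms]
      ring_hom_zero[OF chom int.ring_axioms Z.ring_axioms] by simp
  have f1: "f \<one> = ZMod 4 1"
    using ring_hom_one[OF fhom] ring_hom_one[OF chom] by simp
  have f2: "f (\<one> \<oplus> \<one>) = ZMod 4 2"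
    using ring_hom_add[OF fhom, of \<one> \<one>] ring_hom_add[OF chom, of 1 1] f1 by simp
  have m: "f ((\<one> \<oplus> \<one>) \<otimes> (\<one> \<oplus> \<one>)) = ZMod 4 4"
    using ring_hom_mult[OF fhom, of "\<one> \<oplus> \<one>" "\<one> \<oplus> \<one>"] ring_hom_mult[OF chom, of 2 2] f2 by simp
  have p: "f ((\<one> \<oplus> \<one>) \<oplus> (\<one> \<oplus> \<one>)) = ZMod 4 4"
    using ring_hom_add[OF fhom, of "\<one> \<oplus> \<one>" "\<one> \<oplus> \<one>"] ring_hom_add[OF chom, of 2 2] f2 by simp
  show "\<one> \<oplus> \<one> \<in> carrier R" by simp
  show "\<one> \<oplus> \<one> \<noteq> \<zero>" using f2 f0 by (auto simp: ZMod_eq_mod)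
  have "ZMod 4 4 = ZMod 4 0" by (simp add: ZMod_eq_mod)
  then show "(\<one> \<oplus> \<one>) \<otimes> (\<one> \<oplus> \<one>) = \<zero>" "(\<one> \<oplus> \<one>) \<oplus> (\<one> \<oplus> \<one>) = \<zero>"
    using m p f0 inj by (auto simp: inj_on_def)
qed

section \<open>The classification\<close>

lemma (in cring) is_rho_or_iso_ZFact_four:
  assumes a: "a \<in> carrier R" "a \<noteq> \<zero>" "a \<otimes> a = \<zero>" "a \<oplus> a = \<zero>"
    and R: "carrier R = {\<zero>, \<one>, a, \<one> \<oplus> a}" and card: "card (carrier R) = 4"
  shows "R \<simeq> ZFact 4 \<or> is_rho R"
proof (cases "\<one> \<oplus> \<one> = \<zero>")
  case True
  have "a [^] (2::nat) = \<zero>" using a by (simp add: numeral_2_eq_2)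
  then show ?thesis unfolding is_rho_def
    using True R card by (intro disjI2 conjI bexI[OF _ a(1)])
next
  case False
  have "a \<noteq> \<one>" using a by auto
  moreover have "\<one> \<noteq> \<zero>" using False by auto
  ultimately have "\<one> \<oplus> \<one> \<noteq> \<one>" "\<one> \<oplus> \<one> \<noteq> \<one> \<oplus> a" using a(1) by auto
  moreover have "\<one> \<oplus> \<one> \<in> {\<zero>, \<one>, a, \<one> \<oplus> a}"
    using a_closed[OF one_closed one_closed] unfolding R .
  ultimately have two: "\<one> \<oplus> \<one> = a" using False by simp
  have "R \<simeq> ZFact 4"
    by (rule iso_ZFact_four) (simp_all only: two R a(4) card[unfolded R])
  then show ?thesis ..
qed

theorem theorem3:
  fixes R :: "('a, 'b) ring_scheme"
  assumes "cring R" and "finite (carrier R)" and "\<one>\<^bsub>R\<^esub> \<noteq> \<zero>\<^bsub>R\<^esub>"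
  shows "ring_s R = enat (card (carrier R)) \<longleftrightarrow> field R \<or> R \<simeq> ZFact 4 \<or> is_rho R"
proof -
  interpret cring R by fact
  have "reduces_power R (card (carrier R) - 1) \<longleftrightarrow> \<not> (field R \<or> R \<simeq> ZFact 4 \<or> is_rho R)"
  proof
    have "card {\<zero>\<^bsub>R\<^esub>, \<one>\<^bsub>R\<^esub>} \<le> card (carrier R)" by (rule card_mono) (use assms in auto)
    then have n: "card (carrier R) \<ge> 2" using assms(3) by auto
    assume red: "reduces_power R (card (carrier R) - 1)"
    show "\<not> (field R \<or> R \<simeq> ZFact 4 \<or> is_rho R)"
    proof (intro notI, elim disjE)
      assume "field R"
      then show False
        using field.not_reduces_power_field[OF _ assms(2), of "card (carrier R) - 1"] red n by simp
    next
      assume iso: "R \<simeq> ZFact 4"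
      have "card (carrier R) = 4" using ring_iso_same_card[OF iso] card_ZFact_four by simp
      then have "reduces_power R 3" using red by simp
      moreover obtain a where "a \<in> carrier R" "a \<noteq> \<zero>\<^bsub>R\<^esub>" "a \<otimes>\<^bsub>R\<^esub> a = \<zero>\<^bsub>R\<^esub>"
          "a \<oplus>\<^bsub>R\<^esub> a = \<zero>\<^bsub>R\<^esub>"
        by (rule ZFact_four_nilpotent[OF iso])
      ultimately show False using not_reduces_power_three by simp
    next
      assume rho: "is_rho R"
      then obtain a where a: "a \<in> carrier R" "carrier R = {\<zero>\<^bsub>R\<^esub>, \<one>\<^bsub>R\<^esub>, a, \<one>\<^bsub>R\<^esub> \<oplus>\<^bsub>R\<^esub> a}"
          "\<one>\<^bsub>R\<^esub> \<oplus>\<^bsub>R\<^esub> \<one>\<^bsub>R\<^esub> = \<zero>\<^bsub>R\<^esub>" "a [^]\<^bsub>R\<^esub> (2::nat) = \<zero>\<^bsub>R\<^esub>" and c: "card (carrier R) = 4"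
        unfolding is_rho_def by (elim conjE bexE)
      have "a \<noteq> \<zero>\<^bsub>R\<^esub>"
      proof
        assume "a = \<zero>\<^bsub>R\<^esub>"
        then have "card {\<zero>\<^bsub>R\<^esub>, \<one>\<^bsub>R\<^esub>} = 4" using c unfolding a(2) by (simp add: insert_commute)
        then show False using assms(3) by simp
      qed
      moreover have "a \<otimes>\<^bsub>R\<^esub> a = \<zero>\<^bsub>R\<^esub>" using a(1,4) by (simp add: numeral_2_eq_2)
      moreover have "a \<oplus>\<^bsub>R\<^esub> a = (\<one>\<^bsub>R\<^esub> \<oplus>\<^bsub>R\<^esub> \<one>\<^bsub>R\<^esub>) \<otimes>\<^bsub>R\<^esub> a" using a(1) by algebra
      then have "a \<oplus>\<^bsub>R\<^esub> a = \<zero>\<^bsub>R\<^esub>" using a(1,3) by simp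
      ultimately show False using not_reduces_power_three[of a] a(1) red c by simp
    qed
  next
    assume exc: "\<not> (field R \<or> R \<simeq> ZFact 4 \<or> is_rho R)"
    then have nonfield: "\<not> field R" by simp
    show "reduces_power R (card (carrier R) - 1)"
    proof (rule ccontr)
      assume "\<not> reduces_power R (card (carrier R) - 1)"
      from nonfield_structure[OF assms(2,3) nonfield this] obtain a where
        "a \<in> carrier R" "a \<noteq> \<zero>\<^bsub>R\<^esub>" "a \<otimes>\<^bsub>R\<^esub> a = \<zero>\<^bsub>R\<^esub>" "a \<oplus>\<^bsub>R\<^esub> a = \<zero>\<^bsub>R\<^esub>"
        "carrier R = {\<zero>\<^bsub>R\<^esub>, \<one>\<^bsub>R\<^esub>, a, \<one>\<^bsub>R\<^esub> \<oplus>\<^bsub>R\<^esub> a}" "card (carrier R) = 4" .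
      then have "R \<simeq> ZFact 4 \<or> is_rho R" by (rule is_rho_or_iso_ZFact_four)
      then show False using exc by simp
    qed
  qed
  then show ?thesis using ring_s_eq_card_iff[OF assms(2,3)] by blast
qed

end
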